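(* Let $Y\subset X$ be a normed space such that its positive cone $Y_+$ is normal, and let $Z\subset Y_+$ be a complete subcone such that $|\varphi-\psi|\in Z$ for all $\varphi,\psi\in Z$ and such that $\|\varphi\|=\||\varphi|\|$ for all $\varphi\in Z-Z$. Let $\mathcal{A}$ be a set of subadditive and monotone mappings $A: Z-Z\to Y$ such that $AZ\subset Z$ and such that each $A\in\mathcal{A}$ is positively homogeneous and continuous on $Z$. If the set $\{A\varphi : A\in\mathcal{A}\}$ is bounded for each $\varphi\in Z$ (i.e., for each $\varphi\in Z$ there exists $M_\varphi>0$ such that $\|A\varphi\|\le M_\varphi$ for all $A\in\mathcal{A}$), then there exists $M>0$ such that $\|A\|_{LIP}\le M$ for all $A\in\mathcal{A}$.
   Context: Let $\Omega$ be a non-empty set. $X$ denotes either the real vector space of all functions $\varphi:\Omega\to\mathbb{R}$, or, if $(\Omega,\mathcal{M},\mu)$ is a measure space, the real vector space of all equivalence classes (under almost everywhere equality) of real measurable functions on $\Omega$. For $\varphi\in X$, $|\varphi|\in X$ is the (pointwise) absolute value. For $\varphi,\psi\in X$, $\varphi\le\psi$ means $\varphi(\omega)\le\psi(\omega)$ for all (respectively almost all) $\omega\in\Omega$. For a vector subspace $Y\subset X$, the positive cone is $Y_+=\{\varphi\in Y:\varphi(\omega)\ge 0 \text{ for all (respectively almost all) } \omega\in\Omega\}$; the order on $Y$ and on all its subsets is always the one induced by $Y_+$, i.e. the order $\le$ above. A normed space $Y\subset X$ is a vector subspace of $X$ equipped with a norm $\|\cdot\|$. The cone $Y_+$ is normal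 if there is a constant $C>0$ such that $\|\varphi\|\le C\|\psi\|$ whenever $\varphi\le\psi$ with $\varphi,\psi\in Y_+$. A (sub)cone $Z\subset Y_+$ is a non-empty subset with $Z+Z\subset Z$, $tZ\subset Z$ for all $t\ge 0$, and $Z\cap(-Z)=\{0\}$ (the last condition is automatic for subsets of $Y_+$). It is complete if it is a complete metric space in the metric induced by the norm of $Y$. $Z-Z=\{\varphi_1-\varphi_2:\varphi_1,\varphi_2\in Z\}$, which is a vector subspace of $Y$. A mapping $A:Z-Z\to Y$ is subadditive if $A(\varphi+\psi)\le A\varphi+A\psi$ for all $\varphi,\psi\in Z-Z$, and monotone if $A\varphi\le A\psi$ whenever $\varphi\le\psi$, $\varphi,\psi\in Z-Z$. $A$ is positively homogeneous on $Z$ if $A(t\varphi)=tA(\varphi)$ for all $t\ge0$ and $\varphi\in Z$. Continuity on $Z$ is with respect to the norm. Finally, $$\|A\|_{LIP}=\sup_{\varphi,\psi\in Z,\ \varphi\ne\psi}\frac{\|A\varphi-A\psi\|}{\|\varphi-\psi\|}.$$ *)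

theory Defs
  imports "HOL-Analysis.Analysis"
begin

text \<open>
  The two admissible ambient spaces are treated uniformly. In both of them an element is an
  equivalence class of HOL functions on the type \<open>'a\<close>.
  \<^item> \<open>Everywhere \<Omega>\<close>: all real functions on the set \<open>\<Omega>\<close>. HOL functions are total, so a function on
    \<open>\<Omega>\<close> is the class of all total functions agreeing with it at every point of \<open>\<Omega>\<close> (a singleton
    if \<open>\<Omega> = UNIV\<close>).
  \<^item> \<open>Almost_Everywhere M\<close>: all real measurable functions on the measure space \<open>M\<close>, modulo
    equality almost everywhere.
\<close>

datatype 'a base = Everywhere "'a set" | Almost_Everywhere "'a measure"

primrec base_set :: "'a base \<Rightarrow> 'a set" where
  "base_set (Everywhere \<Omega>) = \<Omega>"
| "base_set (Almost_Everywhere M) = space M"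

primrec holds :: "'a base \<Rightarrow> ('a \<Rightarrow> bool) \<Rightarrow> bool" where
  "holds (Everywhere \<Omega>) P \<longleftrightarrow> (\<forall>\<omega>\<in>\<Omega>. P \<omega>)"
| "holds (Almost_Everywhere M) P \<longleftrightarrow> (AE \<omega> in M. P \<omega>)"

primrec funs :: "'a base \<Rightarrow> ('a \<Rightarrow> real) set" where
  "funs (Everywhere \<Omega>) = UNIV"
| "funs (Almost_Everywhere M) = borel_measurable M"

type_synonym 'a cls = "('a \<Rightarrow> real) set"

definition cls :: "'a base \<Rightarrow> ('a \<Rightarrow> real) \<Rightarrow> 'a cls" where
  "cls B f = {g \<in> funs B. holds B (\<lambda>\<omega>. g \<omega> = f \<omega>)}"

definition ambient :: "'a base \<Rightarrow> 'a cls set" where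
  "ambient B = cls B ` funs B"


subsection \<open>Pointwise operations and order on classes\<close>

definition lift1 :: "'a base \<Rightarrow> (real \<Rightarrow> real) \<Rightarrow> 'a cls \<Rightarrow> 'a cls" where
  "lift1 B h \<phi> = {k \<in> funs B. \<exists>f\<in>\<phi>. holds B (\<lambda>\<omega>. k \<omega> = h (f \<omega>))}"

definition lift2 :: "'a base \<Rightarrow> (real \<Rightarrow> real \<Rightarrow> real) \<Rightarrow> 'a cls \<Rightarrow> 'a cls \<Rightarrow> 'a cls" where
  "lift2 B h \<phi> \<psi> =
     {k \<in> funs B. \<exists>f\<in>\<phi>. \<exists>g\<in>\<psi>. holds B (\<lambda>\<omega>. k \<omega> = h (f \<omega>) (g \<omega>))}"

definition cls_zero :: "'a base \<Rightarrow> 'a cls" ("\<zero>\<index>") where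
  "\<zero>\<^bsub>B\<^esub> = cls B (\<lambda>\<omega>. 0)"

definition cls_add :: "'a base \<Rightarrow> 'a cls \<Rightarrow> 'a cls \<Rightarrow> 'a cls" (infixl "\<oplus>\<index>" 65) where
  "\<phi> \<oplus>\<^bsub>B\<^esub> \<psi> = lift2 B (\<lambda>x y. x + y) \<phi> \<psi>"

definition cls_diff :: "'a base \<Rightarrow> 'a cls \<Rightarrow> 'a cls \<Rightarrow> 'a cls" (infixl "\<ominus>\<index>" 65) where
  "\<phi> \<ominus>\<^bsub>B\<^esub> \<psi> = lift2 B (\<lambda>x y. x - y) \<phi> \<psi>"

definition cls_scale :: "'a base \<Rightarrow> real \<Rightarrow> 'a cls \<Rightarrow> 'a cls" (infixr "\<odot>\<index>" 75) where
  "t \<odot>\<^bsub>B\<^esub> \<phi> = lift1 B (\<lambda>x. t * x) \<phi>"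

definition cls_abs :: "'a base \<Rightarrow> 'a cls \<Rightarrow> 'a cls" where
  "cls_abs B \<phi> = lift1 B (\<lambda>x. \<bar>x\<bar>) \<phi>"

definition cls_le :: "'a base \<Rightarrow> 'a cls \<Rightarrow> 'a cls \<Rightarrow> bool" (infix "\<sqsubseteq>\<index>" 50) where
  "\<phi> \<sqsubseteq>\<^bsub>B\<^esub> \<psi> \<longleftrightarrow> (\<exists>f\<in>\<phi>. \<exists>g\<in>\<psi>. holds B (\<lambda>\<omega>. f \<omega> \<le> g \<omega>))"

lemma holds_mono: "holds B P \<Longrightarrow> (\<And>\<omega>. P \<omega> \<Longrightarrow> Q \<omega>) \<Longrightarrow> holds B Q"
  by (cases B) (auto elim: eventually_mono)

lemma holds_conj: "holds B P \<Longrightarrow> holds B Q \<Longrightarrow> holds B (\<lambda>\<omega>. P \<omega> \<and> Q \<omega>)"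
  by (cases B) auto

lemma holds_True [simp]: "holds B (\<lambda>\<omega>. True)"
  by (cases B) auto

lemma cls_self: "f \<in> funs B \<Longrightarrow> f \<in> cls B f"
  by (simp add: cls_def)

lemma cls_eq_iff:
  assumes "f \<in> funs B" "g \<in> funs B"
  shows "cls B f = cls B g \<longleftrightarrow> holds B (\<lambda>\<omega>. f \<omega> = g \<omega>)"
proof
  assume "cls B f = cls B g"
  then have "f \<in> cls B g" using cls_self[OF assms(1)] by simp
  then show "holds B (\<lambda>\<omega>. f \<omega> = g \<omega>)" by (simp add: cls_def)
next
  assume h: "holds B (\<lambda>\<omega>. f \<omega> = g \<omega>)"
  have "holds B (\<lambda>\<omega>. k \<omega> = f \<omega>) \<longleftrightarrow> holds B (\<lambda>\<omega>. k \<omega> = g \<omega>)" for k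
    using holds_mono[OF holds_conj[OF h]] by (smt (verit))
  then show "cls B f = cls B g" by (simp add: cls_def)
qed

lemma lift1_cls:
  assumes "f \<in> funs B"
  shows "lift1 B h (cls B f) = cls B (\<lambda>\<omega>. h (f \<omega>))"
proof -
  have "holds B (\<lambda>\<omega>. k \<omega> = h (f \<omega>))"
    if "holds B (\<lambda>\<omega>. f' \<omega> = f \<omega>)" "holds B (\<lambda>\<omega>. k \<omega> = h (f' \<omega>))" for f' k
    by (rule holds_mono[OF holds_conj[OF that]]) simp
  then show ?thesis using cls_self[OF assms] by (auto simp: lift1_def cls_def)
qed

lemma lift2_cls:
  assumes "f \<in> funs B" "g \<in> funs B"
  shows "lift2 B h (cls B f) (cls B g) = cls B (\<lambda>\<omega>. h (f \<omega>) (g \<omega>))"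
proof -
  have "holds B (\<lambda>\<omega>. k \<omega> = h (f \<omega>) (g \<omega>))"
    if "holds B (\<lambda>\<omega>. f' \<omega> = f \<omega>)" "holds B (\<lambda>\<omega>. g' \<omega> = g \<omega>)"
      "holds B (\<lambda>\<omega>. k \<omega> = h (f' \<omega>) (g' \<omega>))" for f' g' k
    by (rule holds_mono[OF holds_conj[OF holds_conj[OF that(1,2)] that(3)]]) simp
  then have "lift2 B h (cls B f) (cls B g) \<subseteq> cls B (\<lambda>\<omega>. h (f \<omega>) (g \<omega>))"
    by (auto simp: lift2_def cls_def)
  moreover have "cls B (\<lambda>\<omega>. h (f \<omega>) (g \<omega>)) \<subseteq> lift2 B h (cls B f) (cls B g)"
    unfolding lift2_def using cls_self[OF assms(1)] cls_self[OF assms(2)]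
    by (fastforce simp: cls_def[of B "\<lambda>\<omega>. h (f \<omega>) (g \<omega>)"])
  ultimately show ?thesis by blast
qed

lemma cls_le_cls:
  assumes "f \<in> funs B" "g \<in> funs B"
  shows "cls B f \<sqsubseteq>\<^bsub>B\<^esub> cls B g \<longleftrightarrow> holds B (\<lambda>\<omega>. f \<omega> \<le> g \<omega>)"
proof -
  have "holds B (\<lambda>\<omega>. f \<omega> \<le> g \<omega>)"
    if "holds B (\<lambda>\<omega>. f' \<omega> = f \<omega>)" "holds B (\<lambda>\<omega>. g' \<omega> = g \<omega>)"
      "holds B (\<lambda>\<omega>. f' \<omega> \<le> g' \<omega>)" for f' g'
    by (rule holds_mono[OF holds_conj[OF holds_conj[OF that(1,2)] that(3)]]) simp
  then have "cls B f \<sqsubseteq>\<^bsub>B\<^esub> cls B g \<Longrightarrow> holds B (\<lambda>\<omega>. f \<omega> \<le> g \<omega>)"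
    by (auto simp: cls_le_def cls_def)
  then show ?thesis
    unfolding cls_le_def using cls_self[OF assms(1)] cls_self[OF assms(2)] by blast
qed


subsection \<open>Normed spaces, cones\<close>

definition normed_subspace :: "'a base \<Rightarrow> 'a cls set \<Rightarrow> ('a cls \<Rightarrow> real) \<Rightarrow> bool" where
  "normed_subspace B Y nrm \<longleftrightarrow>
     Y \<subseteq> ambient B \<and> \<zero>\<^bsub>B\<^esub> \<in> Y \<and>
     (\<forall>\<phi>\<in>Y. \<forall>\<psi>\<in>Y. \<phi> \<oplus>\<^bsub>B\<^esub> \<psi> \<in> Y) \<and>
     (\<forall>t. \<forall>\<phi>\<in>Y. t \<odot>\<^bsub>B\<^esub> \<phi> \<in> Y) \<and>
     (\<forall>\<phi>\<in>Y. 0 \<le> nrm \<phi>) \<and>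
     (\<forall>\<phi>\<in>Y. nrm \<phi> = 0 \<longleftrightarrow> \<phi> = \<zero>\<^bsub>B\<^esub>) \<and>
     (\<forall>t. \<forall>\<phi>\<in>Y. nrm (t \<odot>\<^bsub>B\<^esub> \<phi>) = \<bar>t\<bar> * nrm \<phi>) \<and>
     (\<forall>\<phi>\<in>Y. \<forall>\<psi>\<in>Y. nrm (\<phi> \<oplus>\<^bsub>B\<^esub> \<psi>) \<le> nrm \<phi> + nrm \<psi>)"

text \<open>
  The distance is cut off outside \<open>Y\<close> (where \<open>nrm\<close> is unspecified) because the library locale
  \<^locale>\<open>Metric_space\<close> asks for non-negativity and symmetry on the whole type.
\<close>

definition norm_dist :: "'a base \<Rightarrow> 'a cls set \<Rightarrow> ('a cls \<Rightarrow> real) \<Rightarrow> 'a cls \<Rightarrow> 'a cls \<Rightarrow> real" where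
  "norm_dist B Y nrm \<phi> \<psi> = (if \<phi> \<in> Y \<and> \<psi> \<in> Y then nrm (\<phi> \<ominus>\<^bsub>B\<^esub> \<psi>) else 0)"

definition pos_cone :: "'a base \<Rightarrow> 'a cls set \<Rightarrow> 'a cls set" where
  "pos_cone B Y = {\<phi> \<in> Y. \<zero>\<^bsub>B\<^esub> \<sqsubseteq>\<^bsub>B\<^esub> \<phi>}"

definition normal_cone :: "'a base \<Rightarrow> 'a cls set \<Rightarrow> ('a cls \<Rightarrow> real) \<Rightarrow> bool" where
  "normal_cone B K nrm \<longleftrightarrow>
     (\<exists>C>0. \<forall>\<phi>\<in>K. \<forall>\<psi>\<in>K. \<phi> \<sqsubseteq>\<^bsub>B\<^esub> \<psi> \<longrightarrow> nrm \<phi> \<le> C * nrm \<psi>)"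

definition subcone :: "'a base \<Rightarrow> 'a cls set \<Rightarrow> 'a cls set \<Rightarrow> bool" where
  "subcone B K Z \<longleftrightarrow>
     Z \<subseteq> K \<and> Z \<noteq> {} \<and>
     (\<forall>\<phi>\<in>Z. \<forall>\<psi>\<in>Z. \<phi> \<oplus>\<^bsub>B\<^esub> \<psi> \<in> Z) \<and>
     (\<forall>t\<ge>0. \<forall>\<phi>\<in>Z. t \<odot>\<^bsub>B\<^esub> \<phi> \<in> Z) \<and>
     Z \<inter> (\<lambda>\<phi>. (-1) \<odot>\<^bsub>B\<^esub> \<phi>) ` Z = {\<zero>\<^bsub>B\<^esub>}"

definition differences :: "'a base \<Rightarrow> 'a cls set \<Rightarrow> 'a cls set" where
  "differences B Z = {\<phi> \<ominus>\<^bsub>B\<^esub> \<psi> | \<phi> \<psi>. \<phi> \<in> Z \<and> \<psi> \<in> Z}"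


subsection \<open>Mappings\<close>

definition subadditive_on :: "'a base \<Rightarrow> 'a cls set \<Rightarrow> ('a cls \<Rightarrow> 'a cls) \<Rightarrow> bool" where
  "subadditive_on B D A \<longleftrightarrow> (\<forall>\<phi>\<in>D. \<forall>\<psi>\<in>D. A (\<phi> \<oplus>\<^bsub>B\<^esub> \<psi>) \<sqsubseteq>\<^bsub>B\<^esub> A \<phi> \<oplus>\<^bsub>B\<^esub> A \<psi>)"

definition monotone_cls_on :: "'a base \<Rightarrow> 'a cls set \<Rightarrow> ('a cls \<Rightarrow> 'a cls) \<Rightarrow> bool" where
  "monotone_cls_on B D A \<longleftrightarrow> (\<forall>\<phi>\<in>D. \<forall>\<psi>\<in>D. \<phi> \<sqsubseteq>\<^bsub>B\<^esub> \<psi> \<longrightarrow> A \<phi> \<sqsubseteq>\<^bsub>B\<^esub> A \<psi>)"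

definition pos_homogeneous_on :: "'a base \<Rightarrow> 'a cls set \<Rightarrow> ('a cls \<Rightarrow> 'a cls) \<Rightarrow> bool" where
  "pos_homogeneous_on B Z A \<longleftrightarrow> (\<forall>t\<ge>0. \<forall>\<phi>\<in>Z. A (t \<odot>\<^bsub>B\<^esub> \<phi>) = t \<odot>\<^bsub>B\<^esub> A \<phi>)"

text \<open>
  The supremum is taken in \<open>[0, \<infinity>]\<close>, so that it is \<open>\<infinity>\<close> for a non-Lipschitz mapping and \<open>0\<close> for
  the trivial cone.
\<close>

definition lip_norm :: "'a base \<Rightarrow> 'a cls set \<Rightarrow> ('a cls \<Rightarrow> real) \<Rightarrow> ('a cls \<Rightarrow> 'a cls) \<Rightarrow> ennreal" where
  "lip_norm B Z nrm A =
     (SUP (\<phi>, \<psi>) \<in> {(\<phi>, \<psi>). \<phi> \<in> Z \<and> \<psi> \<in> Z \<and> \<phi> \<noteq> \<psi>}.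
        ennreal (nrm (A \<phi> \<ominus>\<^bsub>B\<^esub> A \<psi>) / nrm (\<phi> \<ominus>\<^bsub>B\<^esub> \<psi>)))"

end

theory Submission
  imports Defs
begin

text \<open>
  The Lipschitz bound reduces to a linear bound on the cone. If \<open>A\<close> is subadditive and monotone,
  then \<open>\<phi> = \<psi> + (\<phi> - \<psi>)\<close> and \<open>\<phi> - \<psi> \<le> \<bar>\<phi> - \<psi>\<bar>\<close> give \<open>A \<phi> - A \<psi> \<le> A \<bar>\<phi> - \<psi>\<bar>\<close>. The same holds with
  \<open>\<phi>\<close> and \<open>\<psi>\<close> exchanged, so \<open>\<bar>A \<phi> - A \<psi>\<bar> \<le> A \<bar>\<phi> - \<psi>\<bar>\<close> (lemma \<open>abs_diff_image_le\<close>). Both sides are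
  in the cone, so normality, together with \<open>\<parallel>\<bar>\<eta>\<bar>\<parallel> = \<parallel>\<eta>\<parallel>\<close> for \<open>\<eta>\<close> in \<open>Z - Z\<close>, turns a bound
  \<open>\<parallel>A \<eta>\<parallel> \<le> M \<parallel>\<eta>\<parallel>\<close> on \<open>Z\<close> into the Lipschitz bound \<open>\<parallel>A \<phi> - A \<psi>\<parallel> \<le> C M \<parallel>\<phi> - \<psi>\<parallel>\<close>.

  That the bound on \<open>Z\<close> can be chosen uniformly in \<open>A\<close> is a Banach-Steinhaus theorem for cones
  (lemma \<open>uniform_boundedness_on_cone\<close>). By Baire's theorem in the complete metric space \<open>Z\<close>, all
  \<open>\<parallel>A \<eta>\<parallel>\<close> are at most some \<open>n\<close> for \<open>\<eta>\<close> in some relative ball around some \<open>\<phi>\<^sub>0\<close> in \<open>Z\<close>. In a vector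
  space one would translate the ball to the origin by linearity. A cone is not closed under
  differences and \<open>A\<close> need not be additive, but monotonicity and normality replace this step: for small
  \<open>\<phi>\<close> in \<open>Z\<close> the point \<open>\<phi>\<^sub>0 + \<phi>\<close> is in the ball and \<open>0 \<le> A \<phi> \<le> A (\<phi>\<^sub>0 + \<phi>)\<close>, so
  \<open>\<parallel>A \<phi>\<parallel> \<le> C n\<close>.
\<close>


section \<open>Arithmetic and order of function classes\<close>

lemma funs_closed [simp]:
  assumes "f \<in> funs B" "g \<in> funs B"
  shows "(\<lambda>\<omega>. f \<omega> + g \<omega>) \<in> funs B" "(\<lambda>\<omega>. f \<omega> - g \<omega>) \<in> funs B"
    "(\<lambda>\<omega>. t * f \<omega>) \<in> funs B" "(\<lambda>\<omega>. \<bar>f \<omega>\<bar>) \<in> funs B" "(\<lambda>\<omega>. - f \<omega>) \<in> funs B"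
  using assms by (cases B; simp)+

lemma zero_in_funs [simp]: "(\<lambda>\<omega>. 0) \<in> funs B"
  by (cases B) simp_all

lemma ambientE:
  assumes "\<phi> \<in> ambient B"
  obtains f where "f \<in> funs B" "\<phi> = cls B f"
  using assms by (auto simp: ambient_def)

lemma cls_in_ambient [simp]: "f \<in> funs B \<Longrightarrow> cls B f \<in> ambient B"
  by (simp add: ambient_def)

lemmas cls_arith = cls_zero_def cls_add_def cls_diff_def cls_scale_def cls_abs_def
  lift1_cls lift2_cls cls_le_cls cls_eq_iff

lemma cls_diff_in_ambient:
  "\<phi> \<in> ambient B \<Longrightarrow> \<psi> \<in> ambient B \<Longrightarrow> \<phi> \<ominus>\<^bsub>B\<^esub> \<psi> \<in> ambient B"
  by (auto elim!: ambientE simp: cls_arith)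

lemma cls_zero_in_ambient: "\<zero>\<^bsub>B\<^esub> \<in> ambient B"
  by (simp add: cls_zero_def)

lemma cls_scale_zero: "\<phi> \<in> ambient B \<Longrightarrow> 0 \<odot>\<^bsub>B\<^esub> \<phi> = \<zero>\<^bsub>B\<^esub>"
  by (auto elim!: ambientE simp: cls_arith)

lemma cls_diff_zero: "\<phi> \<in> ambient B \<Longrightarrow> \<phi> \<ominus>\<^bsub>B\<^esub> \<zero>\<^bsub>B\<^esub> = \<phi>"
  by (auto elim!: ambientE simp: cls_arith)

lemma cls_diff_eq_zero_iff:
  "\<phi> \<in> ambient B \<Longrightarrow> \<psi> \<in> ambient B \<Longrightarrow> \<phi> \<ominus>\<^bsub>B\<^esub> \<psi> = \<zero>\<^bsub>B\<^esub> \<longleftrightarrow> \<phi> = \<psi>"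
  by (elim ambientE) (simp add: cls_arith)

lemma cls_diff_conv_add:
  "\<phi> \<in> ambient B \<Longrightarrow> \<psi> \<in> ambient B \<Longrightarrow> \<phi> \<ominus>\<^bsub>B\<^esub> \<psi> = \<phi> \<oplus>\<^bsub>B\<^esub> (-1) \<odot>\<^bsub>B\<^esub> \<psi>"
  by (auto elim!: ambientE simp: cls_arith)

lemma cls_diff_swap:
  "\<phi> \<in> ambient B \<Longrightarrow> \<psi> \<in> ambient B \<Longrightarrow> \<phi> \<ominus>\<^bsub>B\<^esub> \<psi> = (-1) \<odot>\<^bsub>B\<^esub> (\<psi> \<ominus>\<^bsub>B\<^esub> \<phi>)"
  by (auto elim!: ambientE simp: cls_arith)

lemma cls_diff_telescope:
  "\<phi> \<in> ambient B \<Longrightarrow> \<psi> \<in> ambient B \<Longrightarrow> \<eta> \<in> ambient B \<Longrightarrow>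
    \<phi> \<ominus>\<^bsub>B\<^esub> \<eta> = (\<phi> \<ominus>\<^bsub>B\<^esub> \<psi>) \<oplus>\<^bsub>B\<^esub> (\<psi> \<ominus>\<^bsub>B\<^esub> \<eta>)"
  by (auto elim!: ambientE simp: cls_arith)

lemma cls_diff_add_cancel:
  "\<phi> \<in> ambient B \<Longrightarrow> \<psi> \<in> ambient B \<Longrightarrow> \<phi> \<ominus>\<^bsub>B\<^esub> (\<phi> \<oplus>\<^bsub>B\<^esub> \<psi>) = (-1) \<odot>\<^bsub>B\<^esub> \<psi>"
  by (auto elim!: ambientE simp: cls_arith)

lemma cls_add_diff_cancel:
  "\<phi> \<in> ambient B \<Longrightarrow> \<psi> \<in> ambient B \<Longrightarrow> \<psi> \<oplus>\<^bsub>B\<^esub> (\<phi> \<ominus>\<^bsub>B\<^esub> \<psi>) = \<phi>"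
  by (auto elim!: ambientE simp: cls_arith)

lemma cls_abs_diff_commute:
  "\<phi> \<in> ambient B \<Longrightarrow> \<psi> \<in> ambient B \<Longrightarrow> cls_abs B (\<phi> \<ominus>\<^bsub>B\<^esub> \<psi>) = cls_abs B (\<psi> \<ominus>\<^bsub>B\<^esub> \<phi>)"
  by (auto elim!: ambientE simp: cls_arith abs_minus_commute)

lemma cls_le_abs: "\<phi> \<in> ambient B \<Longrightarrow> \<phi> \<sqsubseteq>\<^bsub>B\<^esub> cls_abs B \<phi>"
  by (auto elim!: ambientE simp: cls_arith abs_ge_self)

lemma cls_le_add_nonneg:
  assumes "\<phi> \<in> ambient B" "\<psi> \<in> ambient B" "\<zero>\<^bsub>B\<^esub> \<sqsubseteq>\<^bsub>B\<^esub> \<psi>"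
  shows "\<phi> \<sqsubseteq>\<^bsub>B\<^esub> \<psi> \<oplus>\<^bsub>B\<^esub> \<phi>"
  using assms by (auto elim!: ambientE simp: cls_arith)

lemma cls_le_add_trans:
  assumes "\<phi> \<in> ambient B" "\<psi> \<in> ambient B" "\<eta> \<in> ambient B" "\<eta>' \<in> ambient B"
    and "\<phi> \<sqsubseteq>\<^bsub>B\<^esub> \<psi> \<oplus>\<^bsub>B\<^esub> \<eta>" "\<eta> \<sqsubseteq>\<^bsub>B\<^esub> \<eta>'"
  shows "\<phi> \<sqsubseteq>\<^bsub>B\<^esub> \<psi> \<oplus>\<^bsub>B\<^esub> \<eta>'"
proof -
  obtain f g h h' where *: "f \<in> funs B" "g \<in> funs B" "h \<in> funs B" "h' \<in> funs B"
    "\<phi> = cls B f" "\<psi> = cls B g" "\<eta> = cls B h" "\<eta>' = cls B h'"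
    using assms(1-4) by (auto elim!: ambientE)
  then have "holds B (\<lambda>\<omega>. f \<omega> \<le> g \<omega> + h \<omega>)" "holds B (\<lambda>\<omega>. h \<omega> \<le> h' \<omega>)"
    using assms(5,6) by (simp_all add: cls_arith)
  then have "holds B (\<lambda>\<omega>. f \<omega> \<le> g \<omega> + h' \<omega>)"
    by (rule holds_mono[OF holds_conj]) simp
  then show ?thesis using * by (simp add: cls_arith)
qed

lemma cls_abs_diff_le:
  assumes "\<phi> \<in> ambient B" "\<psi> \<in> ambient B" "\<eta> \<in> ambient B"
    and "\<phi> \<sqsubseteq>\<^bsub>B\<^esub> \<psi> \<oplus>\<^bsub>B\<^esub> \<eta>" "\<psi> \<sqsubseteq>\<^bsub>B\<^esub> \<phi> \<oplus>\<^bsub>B\<^esub> \<eta>"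
  shows "cls_abs B (\<phi> \<ominus>\<^bsub>B\<^esub> \<psi>) \<sqsubseteq>\<^bsub>B\<^esub> \<eta>"
proof -
  obtain f g h where *: "f \<in> funs B" "g \<in> funs B" "h \<in> funs B"
    "\<phi> = cls B f" "\<psi> = cls B g" "\<eta> = cls B h"
    using assms(1-3) by (auto elim!: ambientE)
  then have "holds B (\<lambda>\<omega>. f \<omega> \<le> g \<omega> + h \<omega>)" "holds B (\<lambda>\<omega>. g \<omega> \<le> f \<omega> + h \<omega>)"
    using assms(4,5) by (simp_all add: cls_arith)
  then have "holds B (\<lambda>\<omega>. \<bar>f \<omega> - g \<omega>\<bar> \<le> h \<omega>)"
    by (rule holds_mono[OF holds_conj]) auto
  then show ?thesis using * by (simp add: cls_arith)
qed


section \<open>Normed spaces of functions and their subcones\<close>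

locale normed_function_space =
  fixes B :: "'a base" and Y :: "'a cls set" and nrm :: "'a cls \<Rightarrow> real"
  assumes normed_subspace: "normed_subspace B Y nrm"
begin

lemma
  shows in_ambient: "\<phi> \<in> Y \<Longrightarrow> \<phi> \<in> ambient B"
    and zero_mem: "\<zero>\<^bsub>B\<^esub> \<in> Y"
    and add_mem: "\<phi> \<in> Y \<Longrightarrow> \<psi> \<in> Y \<Longrightarrow> \<phi> \<oplus>\<^bsub>B\<^esub> \<psi> \<in> Y"
    and scale_mem: "\<phi> \<in> Y \<Longrightarrow> t \<odot>\<^bsub>B\<^esub> \<phi> \<in> Y"
    and nrm_nonneg: "\<phi> \<in> Y \<Longrightarrow> 0 \<le> nrm \<phi>"
    and nrm_eq_zero_iff: "\<phi> \<in> Y \<Longrightarrow> nrm \<phi> = 0 \<longleftrightarrow> \<phi> = \<zero>\<^bsub>B\<^esub>"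
    and nrm_scale: "\<phi> \<in> Y \<Longrightarrow> nrm (t \<odot>\<^bsub>B\<^esub> \<phi>) = \<bar>t\<bar> * nrm \<phi>"
    and nrm_triangle: "\<phi> \<in> Y \<Longrightarrow> \<psi> \<in> Y \<Longrightarrow> nrm (\<phi> \<oplus>\<^bsub>B\<^esub> \<psi>) \<le> nrm \<phi> + nrm \<psi>"
  using normed_subspace by (auto simp: normed_subspace_def)

lemma diff_mem: "\<phi> \<in> Y \<Longrightarrow> \<psi> \<in> Y \<Longrightarrow> \<phi> \<ominus>\<^bsub>B\<^esub> \<psi> \<in> Y"
  by (simp add: cls_diff_conv_add in_ambient add_mem scale_mem)

lemma nrm_diff_commute:
  assumes "\<phi> \<in> Y" "\<psi> \<in> Y"
  shows "nrm (\<phi> \<ominus>\<^bsub>B\<^esub> \<psi>) = nrm (\<psi> \<ominus>\<^bsub>B\<^esub> \<phi>)"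
  by (subst cls_diff_swap) (use assms in \<open>simp_all add: in_ambient nrm_scale diff_mem\<close>)

sublocale Metric_space Y "norm_dist B Y nrm"
proof
  fix \<phi> \<psi> \<eta>
  show "0 \<le> norm_dist B Y nrm \<phi> \<psi>"
    by (simp add: norm_dist_def nrm_nonneg diff_mem)
  show "norm_dist B Y nrm \<phi> \<psi> = norm_dist B Y nrm \<psi> \<phi>"
    by (simp add: norm_dist_def nrm_diff_commute)
  show "norm_dist B Y nrm \<phi> \<psi> = 0 \<longleftrightarrow> \<phi> = \<psi>" if "\<phi> \<in> Y" "\<psi> \<in> Y"
    using that by (simp add: norm_dist_def nrm_eq_zero_iff diff_mem cls_diff_eq_zero_iff in_ambient)
  show "norm_dist B Y nrm \<phi> \<eta> \<le> norm_dist B Y nrm \<phi> \<psi> + norm_dist B Y nrm \<psi> \<eta>"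
    if "\<phi> \<in> Y" "\<psi> \<in> Y" "\<eta> \<in> Y"
    using nrm_triangle[OF diff_mem diff_mem, of \<phi> \<psi> \<psi> \<eta>] that
    by (simp add: norm_dist_def in_ambient cls_diff_telescope[symmetric])
qed

lemma zero_mem_subcone:
  assumes "subcone B (pos_cone B Y) Z"
  shows "\<zero>\<^bsub>B\<^esub> \<in> Z"
  using assms by (auto simp: subcone_def)

lemma subset_differences:
  assumes "subcone B (pos_cone B Y) Z"
  shows "Z \<subseteq> differences B Z"
proof
  fix \<phi> assume \<phi>: "\<phi> \<in> Z"
  then have "\<phi> \<in> ambient B"
    using assms in_ambient by (auto simp: subcone_def pos_cone_def)
  then have "\<phi> = \<phi> \<ominus>\<^bsub>B\<^esub> \<zero>\<^bsub>B\<^esub>" by (simp add: cls_diff_zero)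
  then show "\<phi> \<in> differences B Z"
    using \<phi> zero_mem_subcone[OF assms] by (auto simp: differences_def)
qed


section \<open>Uniform boundedness on a complete cone\<close>

text \<open>
  The sets \<open>{\<phi> \<in> Z. \<forall>A\<in>\<A>. nrm (A \<phi>) \<le> n}\<close> are closed and cover \<open>Z\<close>, so one of them has an interior
  point \<open>\<phi>\<^sub>0\<close>. Adding \<open>\<phi>\<^sub>0\<close> moves a neighbourhood of the vertex of \<open>Z\<close> into this set, and order
  together with normality transfers the bound from \<open>\<phi>\<^sub>0 \<oplus>\<^bsub>B\<^esub> \<phi>\<close> to \<open>\<phi>\<close>.
\<close>

lemma uniform_boundedness_on_cone:
  assumes normal: "normal_cone B (pos_cone B Y) nrm"
    and Z: "subcone B (pos_cone B Y) Z"
    and complete: "Metric_space.mcomplete Z (norm_dist B Y nrm)"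
    and mono: "\<And>A. A \<in> \<A> \<Longrightarrow> monotone_cls_on B Z A"
    and pos: "\<And>A. A \<in> \<A> \<Longrightarrow> A ` Z \<subseteq> pos_cone B Y"
    and hom: "\<And>A. A \<in> \<A> \<Longrightarrow> pos_homogeneous_on B Z A"
    and cont: "\<And>A. A \<in> \<A> \<Longrightarrow>
      continuous_map (Metric_space.mtopology Z (norm_dist B Y nrm)) mtopology A"
    and bounded: "\<And>\<phi>. \<phi> \<in> Z \<Longrightarrow> \<exists>M>0. \<forall>A\<in>\<A>. nrm (A \<phi>) \<le> M"
  obtains M where "M > 0" "\<And>A \<phi>. A \<in> \<A> \<Longrightarrow> \<phi> \<in> Z \<Longrightarrow> nrm (A \<phi>) \<le> M * nrm \<phi>"
proof -
  have ZY: "Z \<subseteq> Y" and Zpos: "\<And>\<phi>. \<phi> \<in> Z \<Longrightarrow> \<zero>\<^bsub>B\<^esub> \<sqsubseteq>\<^bsub>B\<^esub> \<phi>"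
    and Zadd: "\<And>\<phi> \<psi>. \<phi> \<in> Z \<Longrightarrow> \<psi> \<in> Z \<Longrightarrow> \<phi> \<oplus>\<^bsub>B\<^esub> \<psi> \<in> Z"
    and Zscale: "\<And>t \<phi>. 0 \<le> t \<Longrightarrow> \<phi> \<in> Z \<Longrightarrow> t \<odot>\<^bsub>B\<^esub> \<phi> \<in> Z"
    using Z by (auto simp: subcone_def pos_cone_def)
  obtain C where C: "C > 0" "\<And>\<phi> \<psi>. \<phi> \<in> pos_cone B Y \<Longrightarrow> \<psi> \<in> pos_cone B Y \<Longrightarrow>
      \<phi> \<sqsubseteq>\<^bsub>B\<^esub> \<psi> \<Longrightarrow> nrm \<phi> \<le> C * nrm \<psi>"
    using normal by (auto simp: normal_cone_def)
  have imageY: "A \<phi> \<in> Y" if "A \<in> \<A>" "\<phi> \<in> Z" for A \<phi>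
    using pos that by (auto simp: pos_cone_def)
  interpret Z: Metric_space Z "norm_dist B Y nrm"
    using ZY by (rule subspace)

  define L where "L n = {\<phi> \<in> Z. \<forall>A\<in>\<A>. nrm (A \<phi>) \<le> real n}" for n
  have closed: "closedin Z.mtopology (L n)" for n
  proof -
    have "closedin Z.mtopology {\<phi> \<in> topspace Z.mtopology. A \<phi> \<in> mcball \<zero>\<^bsub>B\<^esub> (real n)}"
      if "A \<in> \<A>" for A
      using cont[OF that] by (rule closedin_continuous_map_preimage) simp
    moreover have "nrm (\<zero>\<^bsub>B\<^esub> \<ominus>\<^bsub>B\<^esub> \<psi>) = nrm \<psi>" if "\<psi> \<in> Y" for \<psi>
      using that nrm_diff_commute[OF zero_mem that] by (simp add: cls_diff_zero in_ambient)
    then have "{\<phi> \<in> topspace Z.mtopology. A \<phi> \<in> mcball \<zero>\<^bsub>B\<^esub> (real n)} = {\<phi> \<in> Z. nrm (A \<phi>) \<le> real n}"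
      if "A \<in> \<A>" for A
      using imageY[OF that] by (auto simp: norm_dist_def zero_mem)
    ultimately have cl: "closedin Z.mtopology {\<phi> \<in> Z. nrm (A \<phi>) \<le> real n}" if "A \<in> \<A>" for A
      using that by simp
    show ?thesis
    proof (cases "\<A> = {}")
      case True
      then have "L n = topspace Z.mtopology" by (simp add: L_def)
      then show ?thesis by (metis closedin_topspace)
    next
      case False
      then have "L n = (\<Inter>A\<in>\<A>. {\<phi> \<in> Z. nrm (A \<phi>) \<le> real n})" by (auto simp: L_def)
      then show ?thesis using False cl by (auto intro: closedin_Inter)
    qed
  qed
  have cover: "\<Union> (range L) = Z"
  proof
    show "Z \<subseteq> \<Union> (range L)"
    proof
      fix \<phi> assume \<phi>: "\<phi> \<in> Z"
      then obtain M where M: "\<And>A. A \<in> \<A> \<Longrightarrow> nrm (A \<phi>) \<le> M" using bounded by blast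
      obtain n where "M \<le> real n" using real_arch_simple by blast
      then have "\<phi> \<in> L n" using M \<phi> by (force simp: L_def)
      then show "\<phi> \<in> \<Union> (range L)" by blast
    qed
  qed (auto simp: L_def)
  have "\<exists>n. Z.mtopology interior_of L n \<noteq> {}"
  proof (rule ccontr)
    assume "\<not> ?thesis"
    then have "Z.mtopology interior_of \<Union> (range L) = {}"
      using closed complete by (intro Z.metric_Baire_category_alt) auto
    moreover have "Z.mtopology interior_of Z = Z"
      using interior_of_topspace[of Z.mtopology] by simp
    ultimately show False using cover zero_mem_subcone[OF Z] by auto
  qed
  then obtain n \<phi>\<^sub>0 r where \<phi>\<^sub>0: "\<phi>\<^sub>0 \<in> Z" and r: "r > 0" "Z.mball \<phi>\<^sub>0 r \<subseteq> L n"
    using Z.in_interior_of_mball by fastforce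

  have ball: "nrm (A \<phi>) \<le> C * real n" if "A \<in> \<A>" "\<phi> \<in> Z" "nrm \<phi> < r" for A \<phi>
  proof -
    have \<phi>: "\<phi> \<in> Y" and \<phi>\<^sub>0Y: "\<phi>\<^sub>0 \<in> Y" and sum: "\<phi>\<^sub>0 \<oplus>\<^bsub>B\<^esub> \<phi> \<in> Z"
      using that \<phi>\<^sub>0 ZY Zadd by auto
    have "norm_dist B Y nrm \<phi>\<^sub>0 (\<phi>\<^sub>0 \<oplus>\<^bsub>B\<^esub> \<phi>) = nrm \<phi>"
      using \<phi> \<phi>\<^sub>0Y by (simp add: norm_dist_def add_mem cls_diff_add_cancel in_ambient nrm_scale)
    then have "\<phi>\<^sub>0 \<oplus>\<^bsub>B\<^esub> \<phi> \<in> L n"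
      using r(2) \<phi>\<^sub>0 sum that(3) by auto
    then have bound: "nrm (A (\<phi>\<^sub>0 \<oplus>\<^bsub>B\<^esub> \<phi>)) \<le> real n" using that(1) by (simp add: L_def)
    have "\<phi> \<sqsubseteq>\<^bsub>B\<^esub> \<phi>\<^sub>0 \<oplus>\<^bsub>B\<^esub> \<phi>"
      using \<phi> \<phi>\<^sub>0Y Zpos[OF \<phi>\<^sub>0] by (simp add: cls_le_add_nonneg in_ambient)
    then have "A \<phi> \<sqsubseteq>\<^bsub>B\<^esub> A (\<phi>\<^sub>0 \<oplus>\<^bsub>B\<^esub> \<phi>)"
      using mono[OF that(1)] that(2) sum by (simp add: monotone_cls_on_def)
    then have "nrm (A \<phi>) \<le> C * nrm (A (\<phi>\<^sub>0 \<oplus>\<^bsub>B\<^esub> \<phi>))"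
      using pos[OF that(1)] that(2) sum by (intro C(2)) auto
    also have "\<dots> \<le> C * real n" using bound C(1) by simp
    finally show ?thesis .
  qed

  \<comment> \<open>The factor 2 brings \<open>(r / (2 * nrm \<phi>)) \<odot>\<^bsub>B\<^esub> \<phi>\<close> strictly inside the ball; the summand 1 only makes the constant positive if \<open>n = 0\<close>.\<close>
  define M where "M = 2 * C * real n / r + 1"
  show thesis
  proof
    show "M > 0" using C(1) r(1) by (simp add: M_def add_nonneg_pos)
    fix A \<phi> assume A: "A \<in> \<A>" and \<phi>: "\<phi> \<in> Z"
    have \<phi>Y: "\<phi> \<in> Y" using \<phi> ZY by blast
    have scale: "nrm (A (t \<odot>\<^bsub>B\<^esub> \<phi>)) = t * nrm (A \<phi>)" if "t \<ge> 0" for t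
      using hom[OF A] \<phi> that imageY[OF A \<phi>] by (simp add: pos_homogeneous_on_def nrm_scale)
    show "nrm (A \<phi>) \<le> M * nrm \<phi>"
    proof (cases "nrm \<phi> = 0")
      case True
      then have "0 \<odot>\<^bsub>B\<^esub> \<phi> = \<phi>"
        using \<phi>Y by (simp add: nrm_eq_zero_iff cls_scale_zero cls_zero_in_ambient)
      then show ?thesis using scale[of 0] True by simp
    next
      case False
      then have p: "nrm \<phi> > 0" using nrm_nonneg[OF \<phi>Y] by simp
      define t where "t = r / (2 * nrm \<phi>)"
      have t: "t > 0" using p r(1) by (simp add: t_def)
      have "nrm (t \<odot>\<^bsub>B\<^esub> \<phi>) = r / 2"
        using p t \<phi>Y by (simp add: nrm_scale) (simp add: t_def)
      then have "nrm (A (t \<odot>\<^bsub>B\<^esub> \<phi>)) \<le> C * real n"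
        using r(1) t by (intro ball[OF A Zscale[OF _ \<phi>]]) auto
      then have "t * nrm (A \<phi>) \<le> C * real n" using scale t by simp
      then have "nrm (A \<phi>) \<le> 2 * C * real n / r * nrm \<phi>"
        using p r(1) by (simp add: t_def field_simps)
      also have "\<dots> \<le> M * nrm \<phi>" using p by (simp add: M_def distrib_right)
      finally show ?thesis .
    qed
  qed
qed


section \<open>From bounds on the cone to Lipschitz bounds\<close>

text \<open>
  Subadditivity splits off \<open>\<phi> \<ominus>\<^bsub>B\<^esub> \<psi>\<close> from \<open>\<phi> = \<psi> \<oplus>\<^bsub>B\<^esub> (\<phi> \<ominus>\<^bsub>B\<^esub> \<psi>)\<close>, and monotonicity replaces it by its
  modulus. Only this last form is symmetric in \<open>\<phi>\<close> and \<open>\<psi>\<close>, which yields the bound from both sides.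
\<close>

lemma abs_diff_image_le:
  assumes Z: "subcone B (pos_cone B Y) Z"
    and abs: "\<And>\<phi> \<psi>. \<phi> \<in> Z \<Longrightarrow> \<psi> \<in> Z \<Longrightarrow> cls_abs B (\<phi> \<ominus>\<^bsub>B\<^esub> \<psi>) \<in> Z"
    and image: "A ` differences B Z \<subseteq> Y"
    and subadd: "subadditive_on B (differences B Z) A"
    and mono: "monotone_cls_on B (differences B Z) A"
    and "\<phi> \<in> Z" "\<psi> \<in> Z"
  shows "cls_abs B (A \<phi> \<ominus>\<^bsub>B\<^esub> A \<psi>) \<sqsubseteq>\<^bsub>B\<^esub> A (cls_abs B (\<phi> \<ominus>\<^bsub>B\<^esub> \<psi>))"
proof -
  have amb: "\<phi> \<in> ambient B" if "\<phi> \<in> Z" for \<phi>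
    using Z that in_ambient by (auto simp: subcone_def pos_cone_def)
  have image_amb: "A \<eta> \<in> ambient B" if "\<eta> \<in> differences B Z" for \<eta>
    using image that in_ambient by blast
  note ZD = subsetD[OF subset_differences[OF Z]]
  have one_sided: "A \<phi> \<sqsubseteq>\<^bsub>B\<^esub> A \<psi> \<oplus>\<^bsub>B\<^esub> A (cls_abs B (\<phi> \<ominus>\<^bsub>B\<^esub> \<psi>))" if "\<phi> \<in> Z" "\<psi> \<in> Z" for \<phi> \<psi>
  proof (rule cls_le_add_trans)
    have D: "\<phi> \<ominus>\<^bsub>B\<^esub> \<psi> \<in> differences B Z" using that by (auto simp: differences_def)
    have "A (\<psi> \<oplus>\<^bsub>B\<^esub> (\<phi> \<ominus>\<^bsub>B\<^esub> \<psi>)) \<sqsubseteq>\<^bsub>B\<^esub> A \<psi> \<oplus>\<^bsub>B\<^esub> A (\<phi> \<ominus>\<^bsub>B\<^esub> \<psi>)"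
      using subadd D ZD[OF that(2)] by (simp add: subadditive_on_def)
    then show "A \<phi> \<sqsubseteq>\<^bsub>B\<^esub> A \<psi> \<oplus>\<^bsub>B\<^esub> A (\<phi> \<ominus>\<^bsub>B\<^esub> \<psi>)"
      using that by (simp add: cls_add_diff_cancel amb)
    have "\<phi> \<ominus>\<^bsub>B\<^esub> \<psi> \<sqsubseteq>\<^bsub>B\<^esub> cls_abs B (\<phi> \<ominus>\<^bsub>B\<^esub> \<psi>)"
      using that by (simp add: cls_le_abs cls_diff_in_ambient amb)
    then show "A (\<phi> \<ominus>\<^bsub>B\<^esub> \<psi>) \<sqsubseteq>\<^bsub>B\<^esub> A (cls_abs B (\<phi> \<ominus>\<^bsub>B\<^esub> \<psi>))"
      using mono D ZD[OF abs[OF that]] by (simp add: monotone_cls_on_def)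
    show "A (\<phi> \<ominus>\<^bsub>B\<^esub> \<psi>) \<in> ambient B" using D by (rule image_amb)
  qed (use that in \<open>auto intro!: image_amb ZD abs\<close>)
  show ?thesis
  proof (rule cls_abs_diff_le)
    show "A \<psi> \<sqsubseteq>\<^bsub>B\<^esub> A \<phi> \<oplus>\<^bsub>B\<^esub> A (cls_abs B (\<phi> \<ominus>\<^bsub>B\<^esub> \<psi>))"
      using one_sided[of \<psi> \<phi>] assms(6,7) cls_abs_diff_commute[of \<phi> B \<psi>] by (simp add: amb)
  qed (use assms(6,7) one_sided in \<open>auto intro!: image_amb ZD abs\<close>)
qed

end

lemma lip_norm_le:
  assumes "0 \<le> K"
    and "\<And>\<phi> \<psi>. \<phi> \<in> Z \<Longrightarrow> \<psi> \<in> Z \<Longrightarrow> 0 \<le> nrm (\<phi> \<ominus>\<^bsub>B\<^esub> \<psi>)"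
    and "\<And>\<phi> \<psi>. \<phi> \<in> Z \<Longrightarrow> \<psi> \<in> Z \<Longrightarrow> nrm (A \<phi> \<ominus>\<^bsub>B\<^esub> A \<psi>) \<le> K * nrm (\<phi> \<ominus>\<^bsub>B\<^esub> \<psi>)"
  shows "lip_norm B Z nrm A \<le> ennreal K"
  unfolding lip_norm_def
proof (rule SUP_least, clarify)
  fix \<phi> \<psi> assume *: "\<phi> \<in> Z" "\<psi> \<in> Z"
  have "nrm (A \<phi> \<ominus>\<^bsub>B\<^esub> A \<psi>) / nrm (\<phi> \<ominus>\<^bsub>B\<^esub> \<psi>) \<le> K"
  proof (cases "nrm (\<phi> \<ominus>\<^bsub>B\<^esub> \<psi>) = 0")
    case False
    then have "nrm (\<phi> \<ominus>\<^bsub>B\<^esub> \<psi>) > 0" using assms(2)[OF *] by simp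
    then show ?thesis using assms(3)[OF *] by (simp add: pos_divide_le_eq)
  qed (use assms(1) in simp)
  then show "ennreal (nrm (A \<phi> \<ominus>\<^bsub>B\<^esub> A \<psi>) / nrm (\<phi> \<ominus>\<^bsub>B\<^esub> \<psi>)) \<le> ennreal K"
    by (rule ennreal_leI)
qed

theorem theorem2p2:
  fixes B :: "'a base"
    and Y Z :: "'a cls set"
    and nrm :: "'a cls \<Rightarrow> real"
    and \<A> :: "('a cls \<Rightarrow> 'a cls) set"
  assumes "base_set B \<noteq> {}"
    and "normed_subspace B Y nrm"
    and "normal_cone B (pos_cone B Y) nrm"
    and "subcone B (pos_cone B Y) Z"
    and "Metric_space.mcomplete Z (norm_dist B Y nrm)"
    and "\<And>\<phi> \<psi>. \<phi> \<in> Z \<Longrightarrow> \<psi> \<in> Z \<Longrightarrow> cls_abs B (\<phi> \<ominus>\<^bsub>B\<^esub> \<psi>) \<in> Z"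
    and "\<And>\<phi>. \<phi> \<in> differences B Z \<Longrightarrow> nrm \<phi> = nrm (cls_abs B \<phi>)"
    and "\<And>A. A \<in> \<A> \<Longrightarrow> A ` differences B Z \<subseteq> Y"
    and "\<And>A. A \<in> \<A> \<Longrightarrow> subadditive_on B (differences B Z) A"
    and "\<And>A. A \<in> \<A> \<Longrightarrow> monotone_cls_on B (differences B Z) A"
    and "\<And>A. A \<in> \<A> \<Longrightarrow> A ` Z \<subseteq> Z"
    and "\<And>A. A \<in> \<A> \<Longrightarrow> pos_homogeneous_on B Z A"
    and "\<And>A. A \<in> \<A> \<Longrightarrow>
           continuous_map (Metric_space.mtopology Z (norm_dist B Y nrm))
             (Metric_space.mtopology Y (norm_dist B Y nrm)) A"
    and "\<And>\<phi>. \<phi> \<in> Z \<Longrightarrow> \<exists>M>0. \<forall>A\<in>\<A>. nrm (A \<phi>) \<le> M"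
  shows "\<exists>M::real. M > 0 \<and> (\<forall>A\<in>\<A>. lip_norm B Z nrm A \<le> ennreal M)"
proof -
  interpret normed_function_space B Y nrm
    using assms(2) by unfold_locales
  note Z = assms(4)
  have ZP: "Z \<subseteq> pos_cone B Y" using Z by (simp add: subcone_def)
  have ZY: "Z \<subseteq> Y" using ZP by (auto simp: pos_cone_def)
  have ZD: "Z \<subseteq> differences B Z" using Z by (rule subset_differences)
  obtain C where C: "C > 0" "\<And>\<phi> \<psi>. \<phi> \<in> pos_cone B Y \<Longrightarrow> \<psi> \<in> pos_cone B Y \<Longrightarrow>
      \<phi> \<sqsubseteq>\<^bsub>B\<^esub> \<psi> \<Longrightarrow> nrm \<phi> \<le> C * nrm \<psi>"
    using assms(3) by (auto simp: normal_cone_def)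
  obtain M where M: "M > 0" "\<And>A \<phi>. A \<in> \<A> \<Longrightarrow> \<phi> \<in> Z \<Longrightarrow> nrm (A \<phi>) \<le> M * nrm \<phi>"
  proof (rule uniform_boundedness_on_cone[OF assms(3) Z assms(5), of \<A>])
    show "monotone_cls_on B Z A" if "A \<in> \<A>" for A
      using assms(10)[OF that] ZD by (auto simp: monotone_cls_on_def)
    show "A ` Z \<subseteq> pos_cone B Y" if "A \<in> \<A>" for A
      using assms(11)[OF that] ZP by blast
  qed (use assms(12-14) in auto)
  have "lip_norm B Z nrm A \<le> ennreal (C * M)" if A: "A \<in> \<A>" for A
  proof (rule lip_norm_le)
    show "0 \<le> C * M" using C(1) M(1) by simp
    fix \<phi> \<psi> assume *: "\<phi> \<in> Z" "\<psi> \<in> Z"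
    show "0 \<le> nrm (\<phi> \<ominus>\<^bsub>B\<^esub> \<psi>)" using * ZY by (auto intro: nrm_nonneg diff_mem)
    have AZ: "A \<eta> \<in> Z" if "\<eta> \<in> Z" for \<eta> using assms(11)[OF A] that by blast
    have nrm_abs: "nrm (\<eta> \<ominus>\<^bsub>B\<^esub> \<eta>') = nrm (cls_abs B (\<eta> \<ominus>\<^bsub>B\<^esub> \<eta>'))" if "\<eta> \<in> Z" "\<eta>' \<in> Z" for \<eta> \<eta>'
      using that by (intro assms(7)) (auto simp: differences_def)
    \<comment> \<open>Invariance of \<open>Z\<close> under \<open>A\<close> puts \<open>A \<phi> - A \<psi>\<close> into \<open>Z - Z\<close>, so that it may be replaced by its modulus.\<close>
    have "nrm (A \<phi> \<ominus>\<^bsub>B\<^esub> A \<psi>) = nrm (cls_abs B (A \<phi> \<ominus>\<^bsub>B\<^esub> A \<psi>))"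
      using * by (intro nrm_abs AZ)
    also have "\<dots> \<le> C * nrm (A (cls_abs B (\<phi> \<ominus>\<^bsub>B\<^esub> \<psi>)))"
    proof (rule C(2))
      show "cls_abs B (A \<phi> \<ominus>\<^bsub>B\<^esub> A \<psi>) \<sqsubseteq>\<^bsub>B\<^esub> A (cls_abs B (\<phi> \<ominus>\<^bsub>B\<^esub> \<psi>))"
        using abs_diff_image_le[OF Z assms(6) assms(8-10)[OF A] *] by blast
    qed (use * AZ assms(6) ZP in blast)+
    also have "\<dots> \<le> C * (M * nrm (cls_abs B (\<phi> \<ominus>\<^bsub>B\<^esub> \<psi>)))"
      using C(1) M(2)[OF A assms(6)[OF *]] by simp
    also have "\<dots> = C * M * nrm (\<phi> \<ominus>\<^bsub>B\<^esub> \<psi>)" using nrm_abs[OF *] by simp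
    finally show "nrm (A \<phi> \<ominus>\<^bsub>B\<^esub> A \<psi>) \<le> C * M * nrm (\<phi> \<ominus>\<^bsub>B\<^esub> \<psi>)" .
  qed
  then show ?thesis using C(1) M(1) by (intro exI[of _ "C * M"]) auto
qed

end
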